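(* Let $R$ be a commutative ring with unity, let $m\ge 1$ be an integer, and let $\lambda_1,\lambda_3:\mathbb N\times\mathbb Z\to R$ be two families with triangular support of order $m$ such that $\lambda_1(n,0)\,\lambda_3(n,0)=1$ for all $n\in\mathbb N$. Let $$f_n(x)=\sum_{b=0}^{w_m(n)}\lambda_1(n,b)\,x^{n-mb}\in R[x]\qquad(n\in\mathbb N).$$ Then, for every $n\in\mathbb N$, the following are equivalent: (i) for all $1\le k\le w_m(n)$, $$\sum_{b=0}^{k}\lambda_3(n,b)\,\lambda_1(n-mb,k-b)=0;$$ (ii) $$x^n=\sum_{b=0}^{w_m(n)}\lambda_3(n,b)\,f_{n-mb}(x).$$
   Context: $\mathbb N=\{0,1,2,\dots\}$ and $w_m(n)=\lfloor n/m\rfloor$. A family $\lambda:\mathbb N\times\mathbb Z\to R$ has triangular support of order $m$ (written $\lambda\in\Delta_m$) if $\lambda(n,k)=0$ whenever $k<0$ or $k>w_m(n)$. *)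

theory Defs
  imports "HOL-Computational_Algebra.Polynomial"
begin

definition w :: "nat \<Rightarrow> nat \<Rightarrow> nat" where
  "w m n = n div m"

definition triangular_support :: "nat \<Rightarrow> (nat \<Rightarrow> int \<Rightarrow> 'a::zero) \<Rightarrow> bool" where
  "triangular_support m l \<longleftrightarrow> (\<forall>n k. k < 0 \<or> k > int (w m n) \<longrightarrow> l n k = 0)"

(* The natural subtraction does not truncate, since b \<le> n div m gives m * b \<le> n. *)
definition f_poly :: "nat \<Rightarrow> (nat \<Rightarrow> int \<Rightarrow> 'a::comm_monoid_add) \<Rightarrow> nat \<Rightarrow> 'a poly" where
  "f_poly m l n = (\<Sum>b=0..w m n. monom (l n (int b)) (n - m * b))"

end

theory Submission
  imports Defs
begin

text \<open>Expanding each \<open>f_poly\<close> on the right-hand side gives a double sum of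
  monomials of degree n - m(b + j) over the triangle b + j \<le> \<open>w m n\<close>. Collecting by
  k = b + j (\<open>f_poly_expansion\<close>) turns the convolution sum of the criterion into the
  coefficient of x^(n - mk). These degrees are distinct, so coefficients can be read off
  (\<open>coeff_sum_monom_steps\<close>). The one at k = 0 is 1 by the normalisation, hence the sum
  is x^n exactly when all the others vanish.\<close>

lemma smult_sum_right: "smult a (\<Sum>i\<in>S. p i) = (\<Sum>i\<in>S. smult a (p i))"
  by (induction S rule: infinite_finite_induct) (simp_all add: smult_add_right)

lemma le_w_iff: "m \<ge> 1 \<Longrightarrow> k \<le> w m n \<longleftrightarrow> m * k \<le> n"
  by (simp add: w_def less_eq_div_iff_mult_less_eq mult.commute)

lemma f_poly_expansion:
  fixes l1 :: "nat \<Rightarrow> int \<Rightarrow> 'a::comm_semiring_0" and c :: "nat \<Rightarrow> 'a"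
  assumes "m \<ge> 1"
  shows "(\<Sum>b=0..w m n. smult (c b) (f_poly m l1 (n - m * b)))
       = (\<Sum>k=0..w m n. monom (\<Sum>b=0..k. c b * l1 (n - m * b) (int k - int b)) (n - m * k))"
proof -
  let ?W = "w m n"
  let ?g = "\<lambda>b j. monom (c b * l1 (n - m * b) (int j)) (n - m * (b + j))"
  \<comment> \<open>Lowering the degree by m * b shortens the inner sum by exactly b terms, so the
    index pairs fill a full triangle.\<close>
  have w_diff: "w m (n - m * b) = ?W - b" if "b \<le> ?W" for b
  proof -
    have "m * b \<le> n"
      using that assms by (simp add: le_w_iff)
    then have "n div m = (n - m * b + m * b) div m"
      by simp
    also have "\<dots> = (n - m * b) div m + b"
      using assms by (simp del: le_add_diff_inverse2)
    finally show ?thesis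
      by (simp add: w_def)
  qed
  have "(\<Sum>b=0..?W. smult (c b) (f_poly m l1 (n - m * b))) = (\<Sum>b\<le>?W. \<Sum>j\<le>?W - b. ?g b j)"
    by (simp add: f_poly_def smult_sum_right smult_monom w_diff atLeast0AtMost add_mult_distrib2)
  also have "\<dots> = (\<Sum>(b, j)\<in>(SIGMA b:{..?W}. {..?W - b}). ?g b j)"
    by (simp add: sum.Sigma)
  also have "(SIGMA b:{..?W}. {..?W - b}) = {(b, j). b + j \<le> ?W}"
    by auto
  also have "(\<Sum>(b, j)\<in>\<dots>. ?g b j) = (\<Sum>k\<le>?W. \<Sum>b\<le>k. ?g b (k - b))"
    by (rule sum.triangle_reindex_eq)
  \<comment> \<open>Since b \<le> k, the natural difference k - b agrees with the integer
    one.\<close>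
  also have "\<dots> = (\<Sum>k=0..?W. monom (\<Sum>b=0..k. c b * l1 (n - m * b) (int k - int b)) (n - m * k))"
    by (simp add: monom_sum atLeast0AtMost of_nat_diff)
  finally show ?thesis .
qed

text \<open>For j \<le> \<open>w m n\<close> the subtraction n - m * j does not truncate, so with m
  \<ge> 1 distinct j give distinct degrees and no two terms merge.\<close>

lemma coeff_sum_monom_steps:
  fixes s :: "nat \<Rightarrow> 'a::comm_monoid_add"
  assumes "m \<ge> 1" and "k \<le> w m n"
  shows "coeff (\<Sum>j=0..w m n. monom (s j) (n - m * j)) (n - m * k) = s k"
proof -
  have "n - m * j = n - m * k \<longleftrightarrow> j = k" if "j \<le> w m n" for j
  proof -
    have "m * j \<le> n" "m * k \<le> n"
      using that assms by (simp_all add: le_w_iff)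
    then have "n - m * j = n - m * k \<longleftrightarrow> m * j = m * k"
      by linarith
    then show ?thesis
      using assms(1) by simp
  qed
  then show ?thesis
    using assms(2) by (simp add: coeff_sum if_distrib sum.delta cong: if_cong)
qed

(* The sort {comm_ring, comm_monoid_mult} is that of commutative rings with unity; unlike
   comm_ring_1 it does not require 0 \<noteq> 1.  The polynomial x^n is monom 1 n. *)
theorem theorem2p3:
  fixes m n :: nat
    and l1 l3 :: "nat \<Rightarrow> int \<Rightarrow> 'a::{comm_ring, comm_monoid_mult}"
  assumes "m \<ge> 1"
    and "triangular_support m l1"
    and "triangular_support m l3"
    and "\<forall>i. l1 i 0 * l3 i 0 = 1"
  shows "(\<forall>k::nat. 1 \<le> k \<and> k \<le> w m n \<longrightarrow>
            (\<Sum>b=0..k. l3 n (int b) * l1 (n - m * b) (int k - int b)) = 0)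
         \<longleftrightarrow>
         monom 1 n = (\<Sum>b=0..w m n. smult (l3 n (int b)) (f_poly m l1 (n - m * b)))"
proof -
  let ?S = "\<lambda>k. \<Sum>b=0..k. l3 n (int b) * l1 (n - m * b) (int k - int b)"
  let ?P = "\<Sum>k=0..w m n. monom (?S k) (n - m * k)"
  have S0: "?S 0 = 1"
    using assms(4) by (simp add: mult.commute)
  have "(\<forall>k::nat. 1 \<le> k \<and> k \<le> w m n \<longrightarrow> ?S k = 0) \<longleftrightarrow> monom 1 n = ?P"
  proof
    assume "\<forall>k::nat. 1 \<le> k \<and> k \<le> w m n \<longrightarrow> ?S k = 0"
    then have "(\<Sum>k\<in>{0<..w m n}. monom (?S k) (n - m * k)) = 0"
      by (intro sum.neutral) auto
    then show "monom 1 n = ?P"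
      \<comment> \<open>Splitting off k = 0 leaves the leading term x^n plus the vanishing
        tail.\<close>
      using S0 by (simp add: sum.head)
  next
    assume eq: "monom 1 n = ?P"
    show "\<forall>k::nat. 1 \<le> k \<and> k \<le> w m n \<longrightarrow> ?S k = 0"
    proof (intro allI impI)
      fix k assume k: "1 \<le> k \<and> k \<le> w m n"
      then have "m * k \<le> n" "0 < m * k"
        using assms(1) by (simp_all add: le_w_iff)
      \<comment> \<open>For k \<ge> 1 the degree drops strictly below n, where x^n has coefficient
        0.\<close>
      then have "n \<noteq> n - m * k"
        by linarith
      then have "coeff (monom (1::'a) n) (n - m * k) = 0"
        by (simp add: coeff_monom)
      moreover have "coeff ?P (n - m * k) = ?S k"
        using assms(1) k by (intro coeff_sum_monom_steps) auto
      ultimately show "?S k = 0"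
        using eq by simp
    qed
  qed
  then show ?thesis
    by (simp only: f_poly_expansion[OF assms(1)])
qed

end
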